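(* There exist a compact set $K\subseteq\mathbb{R}$ and jets $F_i=(F_i^k)_{0\le k\le2}$ ($1\le i\le3$) and $F_{ij}=(F_{ij}^k)_{0\le k\le 2}$ ($1\le j<i\le3$) of order $2$ on $K$ such that (1) all the jets $(F_i)_{1\le i\le3}$ and $(F_{ij})_{1\le j<i\le3}$ are Whitney fields of class $C^2$ on $K$; (2) for every $1\le k\le2$, $1\le j<i\le3$ and $t\in K$, $$F_{ij}^k(t)=\mathcal{P}^k\big(F_i^0(t),F_j^0(t),F_i^1(t),F_j^1(t),\dots,F_i^k(t),F_j^k(t)\big);$$ (3) for all $1\le j<i\le3$, $A_{ij}(a,b)/V_{ij}(a,b)\to0$ uniformly as $(b-a)\searrow0$ with $a,b\in K$; but there is no $C^2$ horizontal curve $\gamma:\mathbb{R}\to\mathbb{G}_3$ that extends $(F_i)_{1\le i\le3}$ and $(F_{ij})_{1\le j<i\le3}$, i.e. such that $D^k\gamma_i|_K=F_i^k$ for all $1\le i\le 3$ and $D^k\gamma_{ij}|_K=F_{ij}^k$ for all $1\le j<i\le 3$, for every $0\le k\le2$.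
   Context: **Jets and Whitney fields.** Let $m\ge1$ (here $m=2$). A jet of order $m$ on a compact set $K\subseteq\mathbb{R}$ is a collection $F=(F^k)_{0\le k\le m}$ of $m+1$ continuous functions $F^k:K\to\mathbb{R}$. Write $F(a):=F^0(a)$. Its formal Taylor polynomial at $a\in K$ is $T_a^mF(x):=\sum_{k=0}^m\frac{F^k(a)}{k!}(x-a)^k$. A jet $F$ is a Whitney field of class $C^m$ on $K$ if for every $0\le k\le m$, $$\frac{\big|F^k(b)-\sum_{l=0}^{m-k}\frac{F^{k+l}(a)}{l!}(b-a)^l\big|}{|b-a|^{m-k}}\to 0\quad\text{uniformly as } |a-b|\to0,\ a,b\in K,\ a\neq b.$$ $D^k f$ denotes the $k$-th derivative, with $D^0f=f$. **The group $\mathbb{G}_3$.** Write coordinates of $\mathbb{R}^6$ as $x_i$ ($1\le i\le 3$) and $x_{ij}$ ($1\le j<i\le 3$). The free step 2 Carnot group $\mathbb{G}_3$ with $3$ generators is $\mathbb{R}^6$ with product $(x\cdot y)_k=x_k+y_k$ and $(x\cdot y)_{ij}=x_{ij}+y_{ij}+\frac12(x_iy_j-y_ix_j)$. Set, for $1\le k\le 3$, $$X_k=\frac{\partial}{\partial x_k}+\sum_{j>k}\frac{x_j}{2}\frac{\partial}{\partial x_{jk}}-\sum_{j<k}\frac{x_j}{2}\frac{\partial}{\partial x_{kj}}.$$ A (locally) absolutely continuous curve $\gamma$ in $\mathbb{G}_3$ is horizontal if $\gamma'(t)\in\mathrm{Span}\{X_k(\gamma(t)):1\le k\le 3\}$ for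 almost every $t$; it is a $C^m$ horizontal curve if in addition it is of class $C^m$ as a map into $\mathbb{R}^6$. Its components are denoted $\gamma_i$, $\gamma_{ij}$. **The polynomials $\mathcal{P}^k$.** For $k\ge1$, $$\mathcal{P}^k(x_0,y_0,\dots,x_k,y_k):=\frac12\sum_{l=0}^{k-1}\binom{k-1}{l}(x_ly_{k-l}-y_lx_{k-l}).$$ **The quantities $A_{ij}$ and $V_{ij}$** (with $m=2$). For $a,b\in K$ and $1\le j<i\le 3$, $$A_{ij}(a,b):=F_{ij}(b)-F_{ij}(a)-\frac12\int_a^b\big((T_a^mF_i)(T_a^mF_j)'-(T_a^mF_i)'(T_a^mF_j)\big)+\frac12F_j(a)\big(F_i(b)-T_a^mF_i(b)\big)-\frac12F_i(a)\big(F_j(b)-T_a^mF_j(b)\big),$$ $$V_{ij}(a,b):=(b-a)^{2m}+(b-a)^m\int_a^b\big(|(T_a^mF_i)'|+|(T_a^mF_j)'|\big).$$ *)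

theory Defs
  imports "HOL-Analysis.Analysis"
begin

section \<open>Jets and Whitney fields\<close>

text \<open>A jet is given by its coefficient functions \<open>F k\<close>; only the values \<open>F k a\<close> with
  \<open>k \<le> m\<close> and \<open>a \<in> K\<close> are meaningful.\<close>

definition jet :: "nat \<Rightarrow> real set \<Rightarrow> (nat \<Rightarrow> real \<Rightarrow> real) \<Rightarrow> bool" where
  "jet m K F \<longleftrightarrow> (\<forall>k\<le>m. continuous_on K (F k))"

definition taylor :: "nat \<Rightarrow> (nat \<Rightarrow> real \<Rightarrow> real) \<Rightarrow> real \<Rightarrow> real \<Rightarrow> real" where
  "taylor m F a x = (\<Sum>k\<le>m. F k a / fact k * (x - a) ^ k)"

definition whitney_field :: "nat \<Rightarrow> real set \<Rightarrow> (nat \<Rightarrow> real \<Rightarrow> real) \<Rightarrow> bool" where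
  "whitney_field m K F \<longleftrightarrow> jet m K F \<and>
     (\<forall>k\<le>m. \<forall>\<epsilon>>0. \<exists>\<delta>>0. \<forall>a\<in>K. \<forall>b\<in>K. a \<noteq> b \<and> \<bar>a - b\<bar> < \<delta> \<longrightarrow>
        \<bar>F k b - (\<Sum>l\<le>m - k. F (k + l) a / fact l * (b - a) ^ l)\<bar> / \<bar>b - a\<bar> ^ (m - k) < \<epsilon>)"


section \<open>The free step 2 Carnot group with 3 generators\<close>

text \<open>The coordinates of a point of \<open>\<real>\<^sup>6\<close> are listed as
  \<open>x\<^sub>1, x\<^sub>2, x\<^sub>3, x\<^sub>2\<^sub>1, x\<^sub>3\<^sub>1, x\<^sub>3\<^sub>2\<close>.  The functions \<open>hor\<close> and \<open>ver\<close> give the position of \<open>x\<^sub>i\<close>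
  (for \<open>1 \<le> i \<le> 3\<close>) and of \<open>x\<^sub>i\<^sub>j\<close> (for \<open>1 \<le> j < i \<le> 3\<close>) in this list.\<close>

definition hor :: "nat \<Rightarrow> 6" where
  "hor i = of_nat i"

definition ver :: "nat \<Rightarrow> nat \<Rightarrow> 6" where
  "ver i j = (if i = 2 then 4 else if j = 1 then 5 else 6)"

definition gmult :: "real ^ 6 \<Rightarrow> real ^ 6 \<Rightarrow> real ^ 6" where
  "gmult x y = x + y +
     (\<Sum>i\<in>{1..3}. \<Sum>j\<in>{1..<i}.
        ((x $ hor i * y $ hor j - y $ hor i * x $ hor j) / 2) *\<^sub>R axis (ver i j) 1)"

definition hfield :: "nat \<Rightarrow> real ^ 6 \<Rightarrow> real ^ 6" where
  "hfield k x = axis (hor k) 1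
     + (\<Sum>j\<in>{k<..3}. (x $ hor j / 2) *\<^sub>R axis (ver j k) 1)
     - (\<Sum>j\<in>{1..<k}. (x $ hor j / 2) *\<^sub>R axis (ver k j) 1)"

text \<open>The fields \<open>hfield k\<close> are the left-invariant ones extending the coordinate directions at the
  identity.\<close>

lemma hfield_left_invariant:
  assumes "k \<in> {1..3}"
  shows "gmult x (t *\<^sub>R axis (hor k) 1) = x + t *\<^sub>R hfield k x"
proof -
  have s: "{1..3} = {1, 2, 3::nat}" "{Suc 0..3} = {1, 2, 3}" "{1..<1::nat} = {}" "{1..<2::nat} = {1}" "{1..<3::nat} = {1, 2}"
    "{Suc 0..<2} = {1}" "{Suc 0..<3} = {1, 2}"
    "{1<..3::nat} = {2, 3}" "{Suc 0<..3::nat} = {2, 3}" "{2<..3::nat} = {3}" "{3<..3::nat} = {}"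
    by auto
  have "k = 1 \<or> k = 2 \<or> k = 3"
    using assms by auto
  then show ?thesis
    by (auto simp: gmult_def hfield_def s hor_def ver_def axis_def vec_eq_iff)
qed


section \<open>Horizontal curves\<close>

definition locally_absolutely_continuous :: "(real \<Rightarrow> 'a::real_normed_vector) \<Rightarrow> bool" where
  "locally_absolutely_continuous \<gamma> \<longleftrightarrow>
     (\<forall>a b. \<forall>\<epsilon>>0. \<exists>\<delta>>0. \<forall>(n::nat) u v.
        (\<forall>i<n. a \<le> u i \<and> u i \<le> v i \<and> v i \<le> b) \<and>
        disjoint_family_on (\<lambda>i. {u i<..<v i}) {..<n} \<and>
        (\<Sum>i<n. v i - u i) < \<delta> \<longrightarrow>
        (\<Sum>i<n. norm (\<gamma> (v i) - \<gamma> (u i))) < \<epsilon>)"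

definition horizontal :: "(real \<Rightarrow> real ^ 6) \<Rightarrow> bool" where
  "horizontal \<gamma> \<longleftrightarrow> locally_absolutely_continuous \<gamma> \<and>
     (AE t in lebesgue. \<exists>v. (\<gamma> has_vector_derivative v) (at t) \<and>
        v \<in> span ((\<lambda>k. hfield k (\<gamma> t)) ` {1..3}))"

definition nth_derivative ::
    "nat \<Rightarrow> (real \<Rightarrow> 'a::real_normed_vector) \<Rightarrow> real \<Rightarrow> 'a" where
  "nth_derivative k = (\<lambda>f t. vector_derivative f (at t)) ^^ k"

definition of_class_C :: "nat \<Rightarrow> (real \<Rightarrow> 'a::real_normed_vector) \<Rightarrow> bool" where
  "of_class_C m f \<longleftrightarrow>
     (\<forall>k<m. \<forall>t. nth_derivative k f differentiable (at t)) \<and>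
     (\<forall>k\<le>m. continuous_on UNIV (nth_derivative k f))"

definition C_horizontal_curve :: "nat \<Rightarrow> (real \<Rightarrow> real ^ 6) \<Rightarrow> bool" where
  "C_horizontal_curve m \<gamma> \<longleftrightarrow> horizontal \<gamma> \<and> of_class_C m \<gamma>"


section \<open>The quantities in the extension criterion\<close>

text \<open>Here \<open>x l\<close> and \<open>y l\<close> are the arguments \<open>x\<^sub>l\<close> and \<open>y\<^sub>l\<close>; only those with \<open>l \<le> k\<close> occur.\<close>

definition poly_P :: "nat \<Rightarrow> (nat \<Rightarrow> real) \<Rightarrow> (nat \<Rightarrow> real) \<Rightarrow> real" where
  "poly_P k x y = 1 / 2 * (\<Sum>l<k. real ((k - 1) choose l) * (x l * y (k - l) - y l * x (k - l)))"

text \<open>The arguments \<open>Fi\<close>, \<open>Fj\<close> and \<open>Fij\<close> are the jets \<open>F\<^sub>i\<close>, \<open>F\<^sub>j\<close> and \<open>F\<^sub>i\<^sub>j\<close>.\<close>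

definition Aij :: "nat \<Rightarrow> (nat \<Rightarrow> real \<Rightarrow> real) \<Rightarrow> (nat \<Rightarrow> real \<Rightarrow> real) \<Rightarrow>
    (nat \<Rightarrow> real \<Rightarrow> real) \<Rightarrow> real \<Rightarrow> real \<Rightarrow> real" where
  "Aij m Fi Fj Fij a b = Fij 0 b - Fij 0 a
     - 1 / 2 * (LBINT x=a..b. taylor m Fi a x * deriv (taylor m Fj a) x
                            - deriv (taylor m Fi a) x * taylor m Fj a x)
     + 1 / 2 * Fj 0 a * (Fi 0 b - taylor m Fi a b)
     - 1 / 2 * Fi 0 a * (Fj 0 b - taylor m Fj a b)"

definition Vij :: "nat \<Rightarrow> (nat \<Rightarrow> real \<Rightarrow> real) \<Rightarrow> (nat \<Rightarrow> real \<Rightarrow> real) \<Rightarrow>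
    real \<Rightarrow> real \<Rightarrow> real" where
  "Vij m Fi Fj a b = (b - a) ^ (2 * m)
     + (b - a) ^ m * (LBINT x=a..b. \<bar>deriv (taylor m Fi a) x\<bar> + \<bar>deriv (taylor m Fj a) x\<bar>)"

end

theory Submission
  imports Defs
begin

text \<open>
  The criterion fails in three generators because the denominators \<^term>\<open>Vij\<close> see the pairs of
  generators separately, while a linear change of generators mixes them.

  Take \<open>K = {0} \<union> {2\<^sup>-\<^sup>n}\<close>, \<open>F\<^sub>1 = F\<^sub>2 = t\<close>, \<open>F\<^sub>3 = 0\<close>, \<open>F\<^sub>2\<^sub>1 = F\<^sub>3\<^sub>1 = 0\<close> and let
  \<open>F\<^sub>3\<^sub>2\<close> be \<open>t\<^sup>4\<close> on \<open>K\<close> with vanishing higher coefficients, as the polynomial relation demands: in each pair the two jets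
  agree or one of them is zero, so the polynomials \<open>P\<^sup>k\<close> vanish.  Each pair contains a generator of
  unit speed, so each \<open>V\<^sub>i\<^sub>j(a,b)\<close> is at least \<open>(b - a)\<^sup>3\<close>.  Two points \<open>s < t\<close> of \<open>K\<close> satisfy
  \<open>t \<le> 2 (t - s)\<close>, hence \<open>t\<^sup>4 - s\<^sup>4 \<le> 16 (t - s)\<^sup>4\<close>.  This makes \<open>F\<^sub>3\<^sub>2\<close> a Whitney field although its
  higher coefficients vanish, and makes every \<open>A\<^sub>i\<^sub>j\<close> negligible compared with \<open>(b - a)\<^sup>3\<close>.

  For a horizontal extension \<open>\<gamma>\<close>, however, the difference \<open>\<gamma>\<^sub>3\<^sub>2 - \<gamma>\<^sub>3\<^sub>1\<close> is the area swept out by the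
  planar curve \<open>(\<gamma>\<^sub>3, \<gamma>\<^sub>2 - \<gamma>\<^sub>1)\<close>, and both components of that curve have vanishing second order
  jets at \<open>0\<close>: in the generators \<open>X\<^sub>1 + X\<^sub>2, X\<^sub>2, X\<^sub>3\<close> the last two directions are at rest.  If
  \<open>\<gamma>\<close> is of class \<open>C\<^sup>2\<close> then these components are \<open>o(t\<^sup>2)\<close> with derivatives \<open>o(t)\<close>, so the
  area is \<open>o(t\<^sup>4)\<close> (lemma \<open>area_bound\<close>).  Since it should be equal to \<open>t\<^sup>4\<close> on \<open>K\<close>, no such \<open>\<gamma>\<close> exists.
\<close>


section \<open>Dyadic points\<close>

definition dyadic_points :: "real set" where
  "dyadic_points = insert 0 (range (\<lambda>n. (1 / 2) ^ n))"

lemma compact_dyadic_points: "compact dyadic_points"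
  unfolding dyadic_points_def
  by (intro compact_sequence_with_limit LIMSEQ_power_zero) simp

lemma dyadic_points_nonneg: "t \<in> dyadic_points \<Longrightarrow> 0 \<le> t"
  by (auto simp: dyadic_points_def)

lemma dyadic_points_gap:
  assumes "s \<in> dyadic_points" "t \<in> dyadic_points" "s < t"
  shows "s \<le> t / 2"
proof (cases "s = 0")
  case True
  then show ?thesis using dyadic_points_nonneg[OF assms(2)] by simp
next
  case False
  then obtain k where k: "s = (1 / 2) ^ k"
    using assms(1) by (auto simp: dyadic_points_def)
  have "t \<noteq> 0" using dyadic_points_nonneg[OF assms(1)] assms(3) by simp
  then obtain n where n: "t = (1 / 2) ^ n"
    using assms(2) by (auto simp: dyadic_points_def)
  have "n < k"
  proof (rule ccontr)
    assume "\<not> n < k"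
    then have "t \<le> s" unfolding k n by (intro power_decreasing) auto
    then show False using assms(3) by simp
  qed
  then have "s \<le> (1 / 2) ^ Suc n" unfolding k by (intro power_decreasing) auto
  then show ?thesis using n by simp
qed

text \<open>The gap below a point is comparable with the point itself, so on this set \<open>t\<^sup>4\<close> behaves like a
  function all of whose increments are of fourth order.\<close>

lemma dyadic_points_fourth_power:
  assumes "s \<in> dyadic_points" "t \<in> dyadic_points"
  shows "\<bar>t ^ 4 - s ^ 4\<bar> \<le> 16 * \<bar>t - s\<bar> ^ 4"
proof -
  have *: "\<bar>y ^ 4 - x ^ 4\<bar> \<le> 16 * \<bar>y - x\<bar> ^ 4"
    if "x \<in> dyadic_points" "y \<in> dyadic_points" "x < y" for x y
  proof -
    have x: "0 \<le> x" using dyadic_points_nonneg that by auto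
    have "y \<le> 2 * \<bar>y - x\<bar>" using dyadic_points_gap[OF that] that(3) by (simp add: abs_of_pos)
    then have "y ^ 4 \<le> (2 * \<bar>y - x\<bar>) ^ 4" using x that(3) by (intro power_mono) auto
    also have "\<dots> = 16 * \<bar>y - x\<bar> ^ 4" unfolding power_mult_distrib by simp
    finally have "y ^ 4 \<le> 16 * \<bar>y - x\<bar> ^ 4" .
    moreover have "x ^ 4 \<le> y ^ 4" "0 \<le> x ^ 4" using x that(3) by (auto intro: power_mono)
    ultimately show ?thesis by linarith
  qed
  consider "s < t" | "t < s" | "s = t" by linarith
  then show ?thesis
    by cases (use *[of s t] *[of t s] assms in \<open>auto simp: abs_minus_commute\<close>)
qed


section \<open>The jets of the counterexample\<close>

definition identity_jet :: "nat \<Rightarrow> real \<Rightarrow> real" where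
  "identity_jet k t = (if k = 0 then t else if k = 1 then 1 else 0)"

definition flat_jet :: "(real \<Rightarrow> real) \<Rightarrow> nat \<Rightarrow> real \<Rightarrow> real" where
  "flat_jet g k t = (if k = 0 then g t else 0)"

lemma whitney_field_identity_jet: "whitney_field 2 K identity_jet"
proof -
  have "F - (\<Sum>l\<le>2 - k. identity_jet (k + l) a / fact l * (b - a) ^ l) = 0"
    if "k \<le> 2" "F = identity_jet k b" for k F a b
  proof -
    have "k = 0 \<or> k = 1 \<or> k = 2" using that(1) by auto
    then show ?thesis
      by (auto simp: that(2) identity_jet_def numeral_2_eq_2)
  qed
  moreover have "continuous_on K (identity_jet k)" for k
    by (cases "k = 0") (auto simp: identity_jet_def[abs_def])
  ultimately show ?thesis
    unfolding whitney_field_def jet_def by (auto intro: exI[of _ "1::real"])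
qed

text \<open>When the higher coefficients vanish, every Taylor polynomial is constant, so the remainder is
  the increment of the function, and it only has to be of order higher than \<open>m\<close>.\<close>

lemma whitney_field_flat_jet:
  assumes "continuous_on K g" "0 < C"
    and bound: "\<And>a b. a \<in> K \<Longrightarrow> b \<in> K \<Longrightarrow> \<bar>g b - g a\<bar> \<le> C * \<bar>b - a\<bar> ^ Suc m"
  shows "whitney_field m K (flat_jet g)"
  unfolding whitney_field_def jet_def
proof (intro conjI allI impI)
  fix k :: nat
  show "continuous_on K (flat_jet g k)"
    using assms(1) by (cases "k = 0") (auto simp: flat_jet_def[abs_def])
next
  fix k :: nat and \<epsilon> :: real
  assume "k \<le> m" "0 < \<epsilon>"
  have "\<bar>flat_jet g k b - (\<Sum>l\<le>m - k. flat_jet g (k + l) a / fact l * (b - a) ^ l)\<bar>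
          / \<bar>b - a\<bar> ^ (m - k) < \<epsilon>"
    if ab: "a \<in> K" "b \<in> K" "a \<noteq> b" "\<bar>a - b\<bar> < \<epsilon> / C" for a b
  proof (cases "k = 0")
    case True
    have "(\<Sum>l\<le>m. flat_jet g l a / fact l * (b - a) ^ l)
        = (\<Sum>l\<le>m. if l = 0 then g a else 0)"
      by (intro sum.cong) (auto simp: flat_jet_def)
    then have sum: "(\<Sum>l\<le>m. flat_jet g l a / fact l * (b - a) ^ l) = g a" by simp
    have "\<bar>g b - g a\<bar> / \<bar>b - a\<bar> ^ m \<le> C * \<bar>b - a\<bar>"
      using bound[OF ab(1,2)] ab(3) by (simp add: divide_simps mult_ac)
    also have "\<dots> < \<epsilon>"
      using ab(4) \<open>0 < C\<close> by (simp add: field_simps abs_minus_commute)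
    finally show ?thesis
      using True sum by (simp add: flat_jet_def)
  next
    case False
    then show ?thesis using \<open>0 < \<epsilon>\<close> by (simp add: flat_jet_def)
  qed
  then show "\<exists>\<delta>>0. \<forall>a\<in>K. \<forall>b\<in>K. a \<noteq> b \<and> \<bar>a - b\<bar> < \<delta> \<longrightarrow>
      \<bar>flat_jet g k b - (\<Sum>l\<le>m - k. flat_jet g (k + l) a / fact l * (b - a) ^ l)\<bar>
        / \<bar>b - a\<bar> ^ (m - k) < \<epsilon>"
    using \<open>0 < \<epsilon>\<close> \<open>0 < C\<close> by (intro exI[of _ "\<epsilon> / C"]) auto
qed

lemma taylor_identity_jet: "taylor 2 identity_jet a = (\<lambda>x. x)"
  by (rule ext) (simp add: taylor_def identity_jet_def numeral_2_eq_2)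

lemma taylor_flat_jet: "taylor 2 (flat_jet g) a = (\<lambda>x. g a)"
  by (rule ext) (simp add: taylor_def flat_jet_def numeral_2_eq_2)

definition horizontal_jet :: "nat \<Rightarrow> nat \<Rightarrow> real \<Rightarrow> real" where
  "horizontal_jet i = (if i = 3 then flat_jet (\<lambda>t. 0) else identity_jet)"

definition vertical_jet :: "nat \<Rightarrow> nat \<Rightarrow> nat \<Rightarrow> real \<Rightarrow> real" where
  "vertical_jet i j = flat_jet (if i = 3 \<and> j = 2 then (\<lambda>t. t ^ 4) else (\<lambda>t. 0))"

lemma generator_pair_cases:
  assumes "i \<in> {1..3::nat}" "j \<in> {1..<i}"
  obtains "i = 2" "j = 1" | "i = 3" "j = 1" | "i = 3" "j = 2"
  using assms by force

lemma whitney_field_horizontal_jet: "whitney_field 2 K (horizontal_jet i)"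
  unfolding horizontal_jet_def
  by (auto intro: whitney_field_identity_jet whitney_field_flat_jet[of _ _ 1])

lemma whitney_field_vertical_jet: "whitney_field 2 dyadic_points (vertical_jet i j)"
proof -
  have "whitney_field 2 dyadic_points (flat_jet (\<lambda>t. t ^ 4))"
  proof (rule whitney_field_flat_jet[of _ _ 16])
    fix a b assume ab: "a \<in> dyadic_points" "b \<in> dyadic_points"
    have "t \<le> 1" if "t \<in> dyadic_points" for t
      using that by (auto simp: dyadic_points_def power_le_one)
    then have "\<bar>b - a\<bar> \<le> 1"
      using dyadic_points_nonneg ab by (smt (verit))
    then have "\<bar>b - a\<bar> ^ 4 \<le> \<bar>b - a\<bar> ^ Suc 2"
      by (intro power_decreasing) auto
    then show "\<bar>b ^ 4 - a ^ 4\<bar> \<le> 16 * \<bar>b - a\<bar> ^ Suc 2"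
      using dyadic_points_fourth_power[OF ab] by linarith
  qed (auto intro!: continuous_intros)
  moreover have "whitney_field 2 dyadic_points (flat_jet (\<lambda>t. 0))"
    by (rule whitney_field_flat_jet[of _ _ 1]) auto
  ultimately show ?thesis by (simp add: vertical_jet_def)
qed

lemma vertical_jet_eq_poly_P:
  assumes "i \<in> {1..3}" "j \<in> {1..<i}" "k \<in> {1..2}"
  shows "vertical_jet i j k t = poly_P k (\<lambda>l. horizontal_jet i l t) (\<lambda>l. horizontal_jet j l t)"
proof -
  have "k \<noteq> 0" using assms(3) by simp
  then show ?thesis
    using assms(1,2)
    by (elim generator_pair_cases)
      (auto simp: poly_P_def vertical_jet_def horizontal_jet_def flat_jet_def)
qed

lemma Aij_bound:
  assumes "i \<in> {1..3}" "j \<in> {1..<i}" "a \<in> dyadic_points" "b \<in> dyadic_points"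
  shows "\<bar>Aij 2 (horizontal_jet i) (horizontal_jet j) (vertical_jet i j) a b\<bar> \<le> 16 * \<bar>b - a\<bar> ^ 4"
  using dyadic_points_fourth_power[OF assms(3,4)] assms(1,2)
  by (elim generator_pair_cases)
    (auto simp: Aij_def vertical_jet_def horizontal_jet_def taylor_identity_jet taylor_flat_jet
      flat_jet_def identity_jet_def)

text \<open>The index \<open>j\<close> is never \<open>3\<close>, so every pair contains a generator of unit speed.\<close>

lemma Vij_bound:
  assumes "i \<in> {1..3}" "j \<in> {1..<i}" "a < b"
  shows "(b - a) ^ 3 \<le> Vij 2 (horizontal_jet i) (horizontal_jet j) a b"
proof -
  let ?I = "LBINT x=a..b. \<bar>deriv (taylor 2 (horizontal_jet i) a) x\<bar>
      + \<bar>deriv (taylor 2 (horizontal_jet j) a) x\<bar>"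
  have "b - a \<le> ?I"
    using assms
    by (elim generator_pair_cases)
      (auto simp: horizontal_jet_def taylor_identity_jet taylor_flat_jet)
  then have "(b - a) ^ 2 * (b - a) \<le> (b - a) ^ 2 * ?I"
    by (intro mult_left_mono) auto
  moreover have "(b - a) ^ 3 = (b - a) ^ 2 * (b - a)"
    by (simp add: eval_nat_numeral)
  moreover have "0 \<le> (b - a) ^ (2 * 2)"
    using assms(3) by simp
  ultimately show ?thesis
    unfolding Vij_def by linarith
qed

lemma Aij_div_Vij_bound:
  assumes "i \<in> {1..3}" "j \<in> {1..<i}" "a \<in> dyadic_points" "b \<in> dyadic_points" "a < b"
  shows "\<bar>Aij 2 (horizontal_jet i) (horizontal_jet j) (vertical_jet i j) a b
            / Vij 2 (horizontal_jet i) (horizontal_jet j) a b\<bar> \<le> 16 * (b - a)"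
    (is "\<bar>?A / ?V\<bar> \<le> _")
proof -
  have V: "(b - a) ^ 3 \<le> ?V" by (rule Vij_bound) fact+
  have pos: "0 < (b - a) ^ 3" using assms(5) by simp
  have "\<bar>?A\<bar> \<le> 16 * (b - a) * (b - a) ^ 3"
    using Aij_bound[OF assms(1-4)]
    by (simp add: mult.assoc flip: power_Suc del: left_diff_distrib_numeral right_diff_distrib_numeral)
  also have "\<dots> \<le> 16 * (b - a) * ?V"
    using V assms(5) by (intro mult_left_mono) auto
  finally have "\<bar>?A\<bar> \<le> 16 * (b - a) * ?V" .
  moreover have "0 < ?V" using V pos by linarith
  ultimately show ?thesis
    by (simp only: abs_divide abs_of_pos pos_divide_le_eq)
qed


section \<open>The area swept out by a curve with vanishing jet\<close>

text \<open>Since the second derivative vanishes at \<open>0\<close>, the derivative is \<open>o(t)\<close> there; the mean value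
  theorem transfers this to the function.\<close>

lemma flat_at_zero_bound:
  fixes u u' :: "real \<Rightarrow> real"
  assumes deriv: "\<And>t. (u has_real_derivative u' t) (at t)"
    and deriv2: "(u' has_real_derivative 0) (at 0)"
    and zero: "u 0 = 0" "u' 0 = 0"
    and "0 < \<epsilon>"
  obtains \<delta> where "0 < \<delta>"
    "\<And>t. 0 \<le> t \<Longrightarrow> t < \<delta> \<Longrightarrow> \<bar>u' t\<bar> \<le> \<epsilon> * t \<and> \<bar>u t\<bar> \<le> \<epsilon> * t ^ 2"
proof -
  from deriv2 have "((\<lambda>h. u' h / h) \<longlongrightarrow> 0) (at 0)"
    by (simp add: DERIV_def zero)
  from LIM_D[OF this \<open>0 < \<epsilon>\<close>] obtain \<delta> where \<delta>: "0 < \<delta>"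
    "\<And>h. h \<noteq> 0 \<Longrightarrow> \<bar>h\<bar> < \<delta> \<Longrightarrow> \<bar>u' h / h\<bar> < \<epsilon>"
    by auto
  have u': "\<bar>u' t\<bar> \<le> \<epsilon> * t" if "0 \<le> t" "t < \<delta>" for t
  proof (cases "t = 0")
    case True
    then show ?thesis using zero by simp
  next
    case False
    then have "\<bar>u' t / t\<bar> < \<epsilon>" using \<delta>(2)[of t] that by simp
    then show ?thesis using that False by (simp add: abs_divide pos_divide_less_eq)
  qed
  have "\<bar>u t\<bar> \<le> \<epsilon> * t ^ 2" if t: "0 \<le> t" "t < \<delta>" for t
  proof (cases "t = 0")
    case True
    then show ?thesis using zero by simp
  next
    case False
    then obtain z where z: "0 < z" "z < t" "u t - u 0 = (t - 0) * u' z"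
      using MVT2[of 0 t u u'] deriv t by auto
    have "\<bar>u' z\<bar> \<le> \<epsilon> * z" using u'[of z] z t by simp
    also have "\<dots> \<le> \<epsilon> * t" using z \<open>0 < \<epsilon>\<close> by simp
    finally have "t * \<bar>u' z\<bar> \<le> t * (\<epsilon> * t)" using t by (intro mult_left_mono)
    moreover have "\<bar>u t\<bar> = t * \<bar>u' z\<bar>" using z t by (simp add: zero abs_mult)
    ultimately show ?thesis by (simp add: power2_eq_square mult_ac)
  qed
  with u' \<delta>(1) show thesis by (intro that) auto
qed

lemma area_bound:
  fixes u u' w w' area :: "real \<Rightarrow> real"
  assumes u: "\<And>t. (u has_real_derivative u' t) (at t)" "(u' has_real_derivative 0) (at 0)"
      "u 0 = 0" "u' 0 = 0"
    and w: "\<And>t. (w has_real_derivative w' t) (at t)" "(w' has_real_derivative 0) (at 0)"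
      "w 0 = 0" "w' 0 = 0"
    and area: "\<And>t. (area has_real_derivative (w t * u' t - w' t * u t) / 2) (at t)"
      "area 0 = 0"
    and "0 < \<epsilon>"
  obtains \<delta> where "0 < \<delta>" "\<And>t. 0 < t \<Longrightarrow> t < \<delta> \<Longrightarrow> \<bar>area t\<bar> \<le> \<epsilon> ^ 2 * t ^ 4"
proof -
  obtain \<delta>\<^sub>u where \<delta>u: "0 < \<delta>\<^sub>u"
    "\<And>t. 0 \<le> t \<Longrightarrow> t < \<delta>\<^sub>u \<Longrightarrow> \<bar>u' t\<bar> \<le> \<epsilon> * t \<and> \<bar>u t\<bar> \<le> \<epsilon> * t ^ 2"
    using flat_at_zero_bound[OF u \<open>0 < \<epsilon>\<close>] by blast
  obtain \<delta>\<^sub>w where \<delta>w: "0 < \<delta>\<^sub>w"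
    "\<And>t. 0 \<le> t \<Longrightarrow> t < \<delta>\<^sub>w \<Longrightarrow> \<bar>w' t\<bar> \<le> \<epsilon> * t \<and> \<bar>w t\<bar> \<le> \<epsilon> * t ^ 2"
    using flat_at_zero_bound[OF w \<open>0 < \<epsilon>\<close>] by blast
  have "\<bar>area t\<bar> \<le> \<epsilon> ^ 2 * t ^ 4" if t: "0 < t" "t < min \<delta>\<^sub>u \<delta>\<^sub>w" for t
  proof -
    obtain z where z: "0 < z" "z < t"
      "area t - area 0 = (t - 0) * ((w z * u' z - w' z * u z) / 2)"
      using MVT2[of 0 t area "\<lambda>z. (w z * u' z - w' z * u z) / 2"] area t by auto
    have uz: "\<bar>u' z\<bar> \<le> \<epsilon> * z" "\<bar>u z\<bar> \<le> \<epsilon> * z ^ 2" using \<delta>u(2)[of z] z t by auto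
    have wz: "\<bar>w' z\<bar> \<le> \<epsilon> * z" "\<bar>w z\<bar> \<le> \<epsilon> * z ^ 2" using \<delta>w(2)[of z] z t by auto
    have "\<bar>w z * u' z\<bar> \<le> (\<epsilon> * z ^ 2) * (\<epsilon> * z)"
      unfolding abs_mult using uz wz \<open>0 < \<epsilon>\<close> z by (intro mult_mono) auto
    moreover have "\<bar>w' z * u z\<bar> \<le> (\<epsilon> * z) * (\<epsilon> * z ^ 2)"
      unfolding abs_mult using uz wz \<open>0 < \<epsilon>\<close> z by (intro mult_mono) auto
    ultimately have "\<bar>(w z * u' z - w' z * u z) / 2\<bar> \<le> \<epsilon> ^ 2 * z ^ 3"
      by (simp add: power2_eq_square power3_eq_cube mult_ac)
    also have "\<dots> \<le> \<epsilon> ^ 2 * t ^ 3"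
      using z by (intro mult_left_mono power_mono) auto
    finally have "t * \<bar>(w z * u' z - w' z * u z) / 2\<bar> \<le> t * (\<epsilon> ^ 2 * t ^ 3)"
      using t by (intro mult_left_mono) auto
    moreover have "\<bar>area t\<bar> = t * \<bar>(w z * u' z - w' z * u z) / 2\<bar>"
      using z(3) t unfolding area(2) by (simp only: diff_0_right abs_mult abs_of_pos)
    ultimately show ?thesis by (simp add: eval_nat_numeral mult_ac)
  qed
  with \<delta>u(1) \<delta>w(1) show thesis by (intro that[of "min \<delta>\<^sub>u \<delta>\<^sub>w"]) auto
qed


section \<open>Horizontal curves in coordinates\<close>

lemma nth_derivative_Suc:
  "nth_derivative (Suc k) f t = vector_derivative (nth_derivative k f) (at t)"
  by (simp add: nth_derivative_def)

lemma nth_derivative_0: "nth_derivative 0 f = f"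
  by (simp add: nth_derivative_def)

lemma of_class_C_has_vector_derivative:
  assumes "of_class_C m f" "k < m"
  shows "(nth_derivative k f has_vector_derivative nth_derivative (Suc k) f t) (at t)"
  using assms unfolding of_class_C_def nth_derivative_Suc
  by (simp add: vector_derivative_works[symmetric])

lemma nth_derivative_component:
  fixes f :: "real \<Rightarrow> real ^ 'n"
  assumes "of_class_C m f" "k \<le> m"
  shows "nth_derivative k (\<lambda>s. f s $ p) = (\<lambda>t. nth_derivative k f t $ p)"
  using assms(2)
proof (induction k)
  case 0
  then show ?case by (simp add: nth_derivative_0)
next
  case (Suc k)
  have "((\<lambda>s. nth_derivative k f s $ p) has_vector_derivative nth_derivative (Suc k) f t $ p) (at t)"
    for t
    using of_class_C_has_vector_derivative[OF assms(1), of k t] Suc.prems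
    by (intro bounded_linear.has_vector_derivative[OF bounded_linear_vec_nth]) auto
  then show ?case
    using Suc by (auto simp: nth_derivative_Suc vector_derivative_at)
qed

lemma component_has_real_derivative:
  fixes f :: "real \<Rightarrow> real ^ 'n"
  assumes "of_class_C m f" "k < m"
  shows "((\<lambda>s. nth_derivative k f s $ p) has_real_derivative nth_derivative (Suc k) f t $ p) (at t)"
  unfolding has_real_derivative_iff_has_vector_derivative
  by (intro bounded_linear.has_vector_derivative[OF bounded_linear_vec_nth]
      of_class_C_has_vector_derivative[OF assms])

text \<open>The contact equations that cut out the horizontal distribution, for the two vertical
  coordinates involving the third generator.\<close>

lemma span_hfield_contact:
  assumes "v \<in> span ((\<lambda>k. hfield k x) ` {1..3})"
  shows "v $ ver 3 1 = (x $ hor 3 * v $ hor 1 - x $ hor 1 * v $ hor 3) / 2"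
    and "v $ ver 3 2 = (x $ hor 3 * v $ hor 2 - x $ hor 2 * v $ hor 3) / 2"
proof -
  have s: "{1..<1::nat} = {}" "{1..<2::nat} = {1}" "{1..<3::nat} = {1, 2}"
    "{1<..3::nat} = {2, 3}" "{2<..3::nat} = {3}" "{3<..3::nat} = {}"
    "{Suc 0<..3::nat} = {2, 3}" "{Suc 0..<2::nat} = {1}" "{Suc 0..<3::nat} = {1, 2}"
    by auto
  let ?S = "{v. v $ ver 3 1 = (x $ hor 3 * v $ hor 1 - x $ hor 1 * v $ hor 3) / 2
      \<and> v $ ver 3 2 = (x $ hor 3 * v $ hor 2 - x $ hor 2 * v $ hor 3) / 2}"
  have "hfield k x \<in> ?S" if "k \<in> {1..3}" for k
  proof -
    have "k = 1 \<or> k = 2 \<or> k = 3" using that by auto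
    then show ?thesis
      by (auto simp: hfield_def s hor_def ver_def axis_def)
  qed
  moreover have "subspace ?S"
    by (auto simp: subspace_def field_simps) (simp_all flip: distrib_left)
  ultimately have "span ((\<lambda>k. hfield k x) ` {1..3}) \<subseteq> ?S"
    by (intro span_minimal) auto
  then show "v $ ver 3 1 = (x $ hor 3 * v $ hor 1 - x $ hor 1 * v $ hor 3) / 2"
    and "v $ ver 3 2 = (x $ hor 3 * v $ hor 2 - x $ hor 2 * v $ hor 3) / 2"
    using assms by auto
qed

text \<open>Horizontality holds almost everywhere, hence everywhere when the derivative is continuous.
  Subtracting the two contact equations merges the first two generators into their difference.\<close>

lemma horizontal_difference_equation:
  assumes "C_horizontal_curve 2 \<gamma>"
  defines "D \<equiv> nth_derivative 1 \<gamma>"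
  shows "D t $ ver 3 2 - D t $ ver 3 1
    = (\<gamma> t $ hor 3 * (D t $ hor 2 - D t $ hor 1) - D t $ hor 3 * (\<gamma> t $ hor 2 - \<gamma> t $ hor 1)) / 2"
proof -
  have C: "of_class_C 2 \<gamma>" and "horizontal \<gamma>"
    using assms(1) by (auto simp: C_horizontal_curve_def)
  have cont: "continuous_on UNIV D" "continuous_on UNIV \<gamma>"
    using C unfolding of_class_C_def D_def by (auto simp: nth_derivative_0 dest: spec[of _ 0])
  let ?E = "{t. D t $ ver 3 2 - D t $ ver 3 1
    = (\<gamma> t $ hor 3 * (D t $ hor 2 - D t $ hor 1) - D t $ hor 3 * (\<gamma> t $ hor 2 - \<gamma> t $ hor 1)) / 2}"
  have "closed ?E"
    by (intro closed_Collect_eq continuous_intros cont) auto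
  moreover have "AE t in lebesgue. t \<in> ?E"
  proof -
    have "AE t in lebesgue. \<exists>v. (\<gamma> has_vector_derivative v) (at t) \<and>
        v \<in> span ((\<lambda>k. hfield k (\<gamma> t)) ` {1..3})"
      using \<open>horizontal \<gamma>\<close> by (simp add: horizontal_def)
    then show ?thesis
    proof (rule AE_mp, intro AE_I2 impI)
      fix t
      assume "\<exists>v. (\<gamma> has_vector_derivative v) (at t) \<and>
        v \<in> span ((\<lambda>k. hfield k (\<gamma> t)) ` {1..3})"
      then have "D t \<in> span ((\<lambda>k. hfield k (\<gamma> t)) ` {1..3})"
        by (auto simp: D_def nth_derivative_def vector_derivative_at)
      from span_hfield_contact[OF this] show "t \<in> ?E"
        by (simp add: algebra_simps diff_divide_distrib add_divide_distrib)
    qed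
  qed
  ultimately show ?thesis
    using mem_closed_if_AE_lebesgue[of ?E t] by simp
qed

lemma no_horizontal_extension:
  assumes \<gamma>: "C_horizontal_curve 2 \<gamma>"
    and hor_ext: "\<And>k i t. k \<le> 2 \<Longrightarrow> i \<in> {1..3} \<Longrightarrow> t \<in> dyadic_points \<Longrightarrow>
      nth_derivative k (\<lambda>s. \<gamma> s $ hor i) t = horizontal_jet i k t"
    and ver_ext: "\<And>j t. j \<in> {1, 2} \<Longrightarrow> t \<in> dyadic_points \<Longrightarrow>
      \<gamma> t $ ver 3 j = vertical_jet 3 j 0 t"
  shows False
proof -
  have C: "of_class_C 2 \<gamma>" using \<gamma> by (simp add: C_horizontal_curve_def)
  let ?D = "\<lambda>k t. nth_derivative k \<gamma> t"
  have zero: "0 \<in> dyadic_points" by (simp add: dyadic_points_def)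
  have jet0: "?D k 0 $ hor i = horizontal_jet i k 0" if "k \<le> 2" "i \<in> {1..3}" for k i
    using hor_ext[OF that zero] nth_derivative_component[OF C that(1), of "hor i"] by simp
  define u where "u = (\<lambda>t. \<gamma> t $ hor 2 - \<gamma> t $ hor 1)"
  define u' where "u' = (\<lambda>t. ?D 1 t $ hor 2 - ?D 1 t $ hor 1)"
  define w where "w = (\<lambda>t. \<gamma> t $ hor 3)"
  define w' where "w' = (\<lambda>t. ?D 1 t $ hor 3)"
  define area where "area = (\<lambda>t. \<gamma> t $ ver 3 2 - \<gamma> t $ ver 3 1)"
  have D1: "((\<lambda>s. \<gamma> s $ p) has_real_derivative ?D 1 t $ p) (at t)" for p t
    using component_has_real_derivative[OF C, of 0 p t] by (simp add: nth_derivative_0)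
  have D2: "((\<lambda>s. ?D 1 s $ p) has_real_derivative ?D 2 t $ p) (at t)" for p t
    using component_has_real_derivative[OF C, of 1 p t] by (simp add: numeral_2_eq_2)
  have "(u has_real_derivative u' t) (at t)" "(w has_real_derivative w' t) (at t)" for t
    unfolding u_def u'_def w_def w'_def by (intro DERIV_diff D1)+
  moreover have "(u' has_real_derivative 0) (at 0)" "(w' has_real_derivative 0) (at 0)"
    using DERIV_diff[OF D2[of "hor 2" 0] D2[of "hor 1" 0]] D2[of "hor 3" 0] jet0[of 2]
    unfolding u'_def w'_def by (simp_all add: horizontal_jet_def flat_jet_def)
  moreover have "u 0 = 0" "u' 0 = 0" "w 0 = 0" "w' 0 = 0"
    using jet0[of 0] jet0[of 1] unfolding u_def u'_def w_def w'_def
    by (simp_all add: horizontal_jet_def flat_jet_def nth_derivative_0)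
  moreover have "(area has_real_derivative (w t * u' t - w' t * u t) / 2) (at t)" for t
    unfolding area_def u_def u'_def w_def w'_def horizontal_difference_equation[OF \<gamma>, symmetric]
    by (intro DERIV_diff D1)
  moreover have area_eq: "area t = t ^ 4" if "t \<in> dyadic_points" for t
    using ver_ext[OF _ that] by (simp add: area_def vertical_jet_def flat_jet_def)
  moreover have "area 0 = 0" using area_eq[OF zero] by simp
  \<comment> \<open>any factor below \<open>1\<close> contradicts \<open>area t = t\<^sup>4\<close>\<close>
  moreover have "(0::real) < 1 / 2" by simp
  ultimately obtain \<delta> where \<delta>: "0 < \<delta>"
    "\<And>t. 0 < t \<Longrightarrow> t < \<delta> \<Longrightarrow> \<bar>area t\<bar> \<le> (1 / 2) ^ 2 * t ^ 4"
    using area_bound[of u u' w w' area "1 / 2"] by metis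
  obtain n where n: "(1 / 2 :: real) ^ n < \<delta>"
    using real_arch_pow_inv[OF \<delta>(1), of "1 / 2"] by auto
  define t where "t = (1 / 2 :: real) ^ n"
  have "0 < t" "t \<in> dyadic_points" by (auto simp: t_def dyadic_points_def)
  then show False
    using \<delta>(2)[of t] n area_eq[of t] by (simp add: t_def[symmetric] power2_eq_square)
qed


section \<open>The counterexample\<close>

theorem proposition3p2:
  shows "\<exists>(K :: real set) (F :: nat \<Rightarrow> nat \<Rightarrow> real \<Rightarrow> real) (G :: nat \<Rightarrow> nat \<Rightarrow> nat \<Rightarrow> real \<Rightarrow> real).
    compact K \<and>
    (\<forall>i\<in>{1..3}. whitney_field 2 K (F i)) \<and>
    (\<forall>i\<in>{1..3}. \<forall>j\<in>{1..<i}. whitney_field 2 K (G i j)) \<and>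
    (\<forall>k\<in>{1..2}. \<forall>i\<in>{1..3}. \<forall>j\<in>{1..<i}. \<forall>t\<in>K.
       G i j k t = poly_P k (\<lambda>l. F i l t) (\<lambda>l. F j l t)) \<and>
    (\<forall>i\<in>{1..3}. \<forall>j\<in>{1..<i}. \<forall>\<epsilon>>0. \<exists>\<delta>>0. \<forall>a\<in>K. \<forall>b\<in>K. 0 < b - a \<and> b - a < \<delta> \<longrightarrow>
       \<bar>Aij 2 (F i) (F j) (G i j) a b / Vij 2 (F i) (F j) a b\<bar> < \<epsilon>) \<and>
    \<not> (\<exists>\<gamma>. C_horizontal_curve 2 \<gamma> \<and>
         (\<forall>k\<le>2.
           (\<forall>i\<in>{1..3}. \<forall>t\<in>K. nth_derivative k (\<lambda>s. \<gamma> s $ hor i) t = F i k t) \<and>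
           (\<forall>i\<in>{1..3}. \<forall>j\<in>{1..<i}. \<forall>t\<in>K.
             nth_derivative k (\<lambda>s. \<gamma> s $ ver i j) t = G i j k t)))"
proof (rule exI[of _ dyadic_points], rule exI[of _ horizontal_jet], rule exI[of _ vertical_jet],
    intro conjI)
  show "compact dyadic_points" by (rule compact_dyadic_points)
  show "\<forall>i\<in>{1..3}. whitney_field 2 dyadic_points (horizontal_jet i)"
    by (simp add: whitney_field_horizontal_jet)
  show "\<forall>i\<in>{1..3}. \<forall>j\<in>{1..<i}. whitney_field 2 dyadic_points (vertical_jet i j)"
    by (simp add: whitney_field_vertical_jet)
  show "\<forall>k\<in>{1..2}. \<forall>i\<in>{1..3}. \<forall>j\<in>{1..<i}. \<forall>t\<in>dyadic_points.
      vertical_jet i j k t = poly_P k (\<lambda>l. horizontal_jet i l t) (\<lambda>l. horizontal_jet j l t)"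
    using vertical_jet_eq_poly_P by blast
  show "\<forall>i\<in>{1..3}. \<forall>j\<in>{1..<i}. \<forall>\<epsilon>>0. \<exists>\<delta>>0. \<forall>a\<in>dyadic_points. \<forall>b\<in>dyadic_points.
      0 < b - a \<and> b - a < \<delta> \<longrightarrow>
      \<bar>Aij 2 (horizontal_jet i) (horizontal_jet j) (vertical_jet i j) a b
        / Vij 2 (horizontal_jet i) (horizontal_jet j) a b\<bar> < \<epsilon>"
  proof (intro ballI allI impI)
    fix i j :: nat and \<epsilon> :: real
    assume ij: "i \<in> {1..3}" "j \<in> {1..<i}" and "0 < \<epsilon>"
    have "\<bar>Aij 2 (horizontal_jet i) (horizontal_jet j) (vertical_jet i j) a b
        / Vij 2 (horizontal_jet i) (horizontal_jet j) a b\<bar> < \<epsilon>"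
      if "a \<in> dyadic_points" "b \<in> dyadic_points" "0 < b - a" "b - a < \<epsilon> / 16" for a b
      using Aij_div_Vij_bound[OF ij that(1,2)] that(3,4) by simp
    then show "\<exists>\<delta>>0. \<forall>a\<in>dyadic_points. \<forall>b\<in>dyadic_points. 0 < b - a \<and> b - a < \<delta> \<longrightarrow>
        \<bar>Aij 2 (horizontal_jet i) (horizontal_jet j) (vertical_jet i j) a b
          / Vij 2 (horizontal_jet i) (horizontal_jet j) a b\<bar> < \<epsilon>"
      using \<open>0 < \<epsilon>\<close> by (intro exI[of _ "\<epsilon> / 16"]) auto
  qed
  show "\<not> (\<exists>\<gamma>. C_horizontal_curve 2 \<gamma> \<and>
      (\<forall>k\<le>2.
        (\<forall>i\<in>{1..3}. \<forall>t\<in>dyadic_points.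
          nth_derivative k (\<lambda>s. \<gamma> s $ hor i) t = horizontal_jet i k t) \<and>
        (\<forall>i\<in>{1..3}. \<forall>j\<in>{1..<i}. \<forall>t\<in>dyadic_points.
          nth_derivative k (\<lambda>s. \<gamma> s $ ver i j) t = vertical_jet i j k t)))"
  proof (rule notI, elim exE conjE)
    fix \<gamma> :: "real \<Rightarrow> real ^ 6"
    assume \<gamma>: "C_horizontal_curve 2 \<gamma>"
      and ext: "\<forall>k\<le>2.
        (\<forall>i\<in>{1..3}. \<forall>t\<in>dyadic_points.
          nth_derivative k (\<lambda>s. \<gamma> s $ hor i) t = horizontal_jet i k t) \<and>
        (\<forall>i\<in>{1..3}. \<forall>j\<in>{1..<i}. \<forall>t\<in>dyadic_points.
          nth_derivative k (\<lambda>s. \<gamma> s $ ver i j) t = vertical_jet i j k t)"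
    show False
    proof (rule no_horizontal_extension[OF \<gamma>])
      fix j :: nat and t :: real
      assume "j \<in> {1, 2}" "t \<in> dyadic_points"
      then have "nth_derivative 0 (\<lambda>s. \<gamma> s $ ver 3 j) t = vertical_jet 3 j 0 t"
        using ext[rule_format, of 0] by auto
      then show "\<gamma> t $ ver 3 j = vertical_jet 3 j 0 t" by (simp add: nth_derivative_0)
    qed (use ext in blast)
  qed
qed

end
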